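(* The set $\mathcal{C}:=\{\lambda\in\mathbb{C} : R_\lambda \text{ is convex}\}$ is an open subset of $\mathbb{C}$.
   Context: For $\lambda\in\mathbb{C}$, a set $S\subseteq\mathbb{C}$ is $\lambda$-convex if for all $a,b\in S$ the point $(1-\lambda)a+\lambda b$ is in $S$; it is $\lambda$-clonvex if it is $\lambda$-convex and topologically closed in $\mathbb{C}$. $R_\lambda$ denotes the smallest $\lambda$-clonvex set containing $\{0,1\}$. "Convex" has the usual meaning. *)

theory Defs
  imports "HOL-Analysis.Analysis"
begin

definition lambda_convex :: "complex \<Rightarrow> complex set \<Rightarrow> bool" where
  "lambda_convex l S \<longleftrightarrow> (\<forall>a\<in>S. \<forall>b\<in>S. (1 - l) * a + l * b \<in> S)"

definition lambda_clonvex :: "complex \<Rightarrow> complex set \<Rightarrow> bool" where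
  "lambda_clonvex l S \<longleftrightarrow> lambda_convex l S \<and> closed S"

text \<open>
  \<open>R l\<close> is the smallest \<open>l\<close>-clonvex set containing \<open>{0, 1}\<close>. The operator \<open>hull\<close> forms
  the intersection of all such sets; by the lemmas below this is itself such a set.
\<close>

definition R :: "complex \<Rightarrow> complex set" where
  "R l = lambda_clonvex l hull {0, 1}"

lemma lambda_clonvex_Inter:
  assumes "\<And>S. S \<in> F \<Longrightarrow> lambda_clonvex l S"
  shows "lambda_clonvex l (\<Inter>F)"
  using assms unfolding lambda_clonvex_def lambda_convex_def by (auto intro: closed_Inter)

lemma lambda_clonvex_R: "lambda_clonvex l (R l)"
  unfolding R_def by (rule hull_in) (rule lambda_clonvex_Inter, blast)

lemma zero_one_subset_R: "{0, 1} \<subseteq> R l"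
  unfolding R_def by (rule hull_subset)

lemma R_minimal: "\<lbrakk>{0, 1} \<subseteq> S; lambda_clonvex l S\<rbrakk> \<Longrightarrow> R l \<subseteq> S"
  unfolding R_def by (rule hull_minimal)

end

theory Submission
  imports Defs
begin

text \<open>
  If \<open>m \<in> R l\<close> then \<open>R l\<close> is \<open>m\<close>-convex, so \<open>R l\<close> is convex as soon as it contains a real number
  strictly between 0 and 1. Every \<open>m\<close> close to \<open>1/2\<close> has this property. This is clear for real \<open>m\<close>.
  Otherwise \<open>R m\<close> contains a curve-like set from \<open>m\<close> to \<open>1\<close>; its images under the powers of \<open>m\<close> spiral
  around 0 inside \<open>R m\<close> and have to meet the positive real axis.
  Finally, if \<open>R l\<close> is convex, then \<open>1/2\<close> is a limit of values at \<open>l\<close> of polynomials \<open>f\<close> with \<open>f l' \<in> R l'\<close>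
  for all \<open>l'\<close>. One of them takes values near \<open>1/2\<close> on a neighbourhood of \<open>l\<close>, and there
  \<open>R (f l') \<subseteq> R l'\<close> makes \<open>R l'\<close> convex.
\<close>

section \<open>Elements of \<open>R l\<close> as parameters\<close>

lemma lambda_convexD:
  "lambda_convex l S \<Longrightarrow> a \<in> S \<Longrightarrow> b \<in> S \<Longrightarrow> (1 - l) * a + l * b \<in> S"
  unfolding lambda_convex_def by blast

lemma closed_R: "closed (R l)"
  and lambda_convex_R: "lambda_convex l (R l)"
  using lambda_clonvex_R[of l] unfolding lambda_clonvex_def by auto

lemma zero_in_R: "0 \<in> R l" and one_in_R: "1 \<in> R l"
  using zero_one_subset_R[of l] by auto

lemma parameter_in_R: "l \<in> R l"
  using lambda_convexD[OF lambda_convex_R zero_in_R one_in_R, of l] by simp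

text \<open>Combining an \<open>m\<close>-combination and a \<open>k\<close>-combination of the same
  two points with weight \<open>l\<close> gives their combination with parameter
  \<open>(1 - l) * m + l * k\<close>. For \<open>S = R l\<close> the parameter set also contains 0
  and 1, so by minimality it contains \<open>R l\<close>.\<close>

lemma lambda_convex_parameters:
  assumes "lambda_convex l S" "closed S"
  shows "lambda_clonvex l {m. lambda_convex m S}"
  unfolding lambda_clonvex_def
proof
  show "lambda_convex l {m. lambda_convex m S}"
  proof (unfold lambda_convex_def[of l], safe)
    fix m k assume m: "lambda_convex m S" and k: "lambda_convex k S"
    show "lambda_convex ((1 - l) * m + l * k) S"
      unfolding lambda_convex_def
    proof safe
      fix a b assume "a \<in> S" "b \<in> S"
      then have "(1 - l) * ((1 - m) * a + m * b) + l * ((1 - k) * a + k * b) \<in> S"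
        using assms(1) m k by (intro lambda_convexD)
      then show "(1 - ((1 - l) * m + l * k)) * a + ((1 - l) * m + l * k) * b \<in> S"
        by (simp add: algebra_simps)
    qed
  qed
  have "{m. lambda_convex m S} = (\<Inter>a\<in>S. \<Inter>b\<in>S. (\<lambda>m. (1 - m) * a + m * b) -` S)"
    unfolding lambda_convex_def by auto
  moreover have "closed ((\<lambda>m. (1 - m) * a + m * b) -` S)" for a b
    by (intro closed_vimage assms continuous_intros)
  ultimately show "closed {m. lambda_convex m S}" by (simp add: closed_INT)
qed

lemma lambda_convex_mem_R:
  assumes "m \<in> R l"
  shows "lambda_convex m (R l)"
proof -
  have "{0, 1} \<subseteq> {m. lambda_convex m (R l)}" by (auto simp: lambda_convex_def)
  then show ?thesis
    using R_minimal[OF _ lambda_convex_parameters[OF lambda_convex_R closed_R]] assms by blast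
qed

lemma R_subset_R: "m \<in> R l \<Longrightarrow> R m \<subseteq> R l"
  using R_minimal[OF zero_one_subset_R] lambda_convex_mem_R closed_R
  unfolding lambda_clonvex_def by blast

lemma R_one_minus: "R (1 - l) = R l"
proof
  have *: "1 - k \<in> R k" for k
    using lambda_convexD[OF lambda_convex_R one_in_R zero_in_R, of k] by simp
  show "R (1 - l) \<subseteq> R l" by (rule R_subset_R[OF *])
  show "R l \<subseteq> R (1 - l)" using R_subset_R[OF *[of "1 - l"]] by simp
qed

section \<open>Convexity from a real parameter\<close>

text \<open>A closed subset of a segment that misses a point has a gap around it. The combination
  with parameter \<open>t\<close> of the two ends of the gap would lie strictly inside it.\<close>

lemma convex_if_lambda_convex_real:
  fixes t :: real
  assumes cl: "closed S" and cv: "lambda_convex (of_real t) S" and t: "0 < t" "t < 1"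
  shows "convex S"
proof (rule convexI)
  fix a b :: complex and v u :: real
  assume ab: "a \<in> S" "b \<in> S" and uv: "0 \<le> v" "0 \<le> u" "v + u = 1"
  define T where "T = {s. (1 - s) *\<^sub>R a + s *\<^sub>R b \<in> S}"
  have T_closed: "closed T"
    unfolding T_def
    by (intro closed_vimage[OF cl, of "\<lambda>s. (1 - s) *\<^sub>R a + s *\<^sub>R b", unfolded vimage_def]
        continuous_intros)
  have T_mid: "(1 - t) * x + t * y \<in> T" if "x \<in> T" "y \<in> T" for x y
  proof -
    have "(1 - of_real t) * ((1 - x) *\<^sub>R a + x *\<^sub>R b)
        + of_real t * ((1 - y) *\<^sub>R a + y *\<^sub>R b) \<in> S"
      using that unfolding T_def by (intro lambda_convexD[OF cv]) auto
    then show ?thesis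
      by (simp add: T_def scaleR_conv_of_real algebra_simps)
  qed
  \<comment> \<open>\<open>x\<close> and \<open>y\<close> are the points of \<open>T\<close> nearest
    to \<open>u\<close> from below and from above.\<close>
  define x where "x = Sup (T \<inter> {0..u})"
  define y where "y = Inf (T \<inter> {u..1})"
  have T01: "0 \<in> T \<inter> {0..u}" "1 \<in> T \<inter> {u..1}" using ab uv by (auto simp: T_def)
  have x: "x \<in> T \<inter> {0..u}" unfolding x_def
    using T01(1) T_closed by (intro closed_contains_Sup closed_Int) auto
  have y: "y \<in> T \<inter> {u..1}" unfolding y_def
    using T01(2) T_closed by (intro closed_contains_Inf closed_Int) auto
  define z where "z = (1 - t) * x + t * y"
  have z_eq: "z - x = t * (y - x)" "y - z = (1 - t) * (y - x)"
    by (simp_all add: z_def algebra_simps)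
  have "x \<le> y" using x y by auto
  then have "x \<le> z" "z \<le> y" using z_eq t by (metis diff_ge_0_iff_ge less_imp_le mult_nonneg_nonneg)+
  moreover have zT: "z \<in> T" using x y T_mid by (auto simp: z_def)
  moreover have "z \<le> x" if "z \<le> u"
    unfolding x_def using that zT x \<open>x \<le> z\<close> by (intro cSup_upper) auto
  moreover have "y \<le> z" if "u \<le> z"
    unfolding y_def using that zT y \<open>z \<le> y\<close> by (intro cInf_lower) auto
  ultimately have "x = y" using z_eq t by (cases "z \<le> u") auto
  then have "u \<in> T" using x y by auto
  then show "v *\<^sub>R a + u *\<^sub>R b \<in> S" using uv by (simp add: T_def algebra_simps flip: uv(3))
qed

lemma convex_R_if_real_mem:
  "of_real t \<in> R l \<Longrightarrow> 0 < t \<Longrightarrow> t < 1 \<Longrightarrow> convex (R l)"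
  using convex_if_lambda_convex_real closed_R lambda_convex_mem_R by blast

lemma half_in_R_if_convex:
  assumes "convex (R l)"
  shows "1/2 \<in> R l"
  using convexD[OF assms zero_in_R one_in_R, of "1/2" "1/2"] by (simp add: scaleR_conv_of_real)

section \<open>An intermediate value theorem on clonvex sets\<close>

text \<open>
  Replacing the pair \<open>(a, b)\<close> by \<open>(a, m)\<close> or \<open>(m, b)\<close> with \<open>m = (1 - l) a + l b\<close> is a bisection
  step that shrinks the distance. So a closest admissible pair, which exists by compactness, is a single
  point. The radius is the sum of the distances that \<open>b\<close> can move in all steps.
\<close>
lemma lambda_clonvex_IVT:
  fixes h :: "complex \<Rightarrow> real"
  assumes S: "lambda_clonvex l S" and ab: "a \<in> S" "b \<in> S"
    and q: "norm l \<le> q" "norm (1 - l) \<le> q" "q < 1"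
    and h: "continuous_on (cball b (q / (1 - q) * dist a b)) h"
    and c: "h b \<le> c" "c \<le> h a"
  obtains p where "p \<in> S" "p \<in> cball b (q / (1 - q) * dist a b)" "h p = c"
proof -
  define k where "k = q / (1 - q)"
  define B where "B = cball b (k * dist a b)"
  define D where "D = {p \<in> B. h p \<le> c} \<inter> S"
  define U where "U = {p \<in> B. c \<le> h p} \<inter> S"
  \<comment> \<open>The inequality is a budget for future moves: \<open>k\<close> is the sum of the
    powers \<open>q^i\<close> with \<open>i\<close> at least 1, so a step that moves
    \<open>b\<close> by at most \<open>q * dist x y\<close> and shrinks the pair by \<open>q\<close>
    stays within it.\<close>
  define K where "K = (U \<times> D) \<inter> {z. dist b (snd z) + k * dist (fst z) (snd z) \<le> k * dist a b}"
  have hB: "continuous_on B h" using h by (simp add: B_def k_def)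
  have clS: "closed S" and cvS: "lambda_convex l S" using S by (auto simp: lambda_clonvex_def)
  \<comment> \<open>The bound \<open>1 \<le> k\<close> lets the budget keep the first point of a
    pair in the ball too, not only the second.\<close>
  have "1 \<le> 2 * q" using q norm_triangle_ineq[of l "1 - l"] by simp
  then have k: "1 \<le> k" "q + k * q = k" using q by (simp_all add: k_def field_simps)
  have inB: "x \<in> B" "y \<in> B" if "dist b y + k * dist x y \<le> k * dist a b" for x y
  proof -
    have "dist x y \<le> k * dist x y" using k mult_right_mono[of 1 k "dist x y"] by simp
    moreover have "dist b x \<le> dist b y + dist x y" by (metis dist_commute dist_triangle)
    moreover have "0 \<le> dist x y" by simp
    ultimately show "x \<in> B" "y \<in> B"
      using that unfolding B_def mem_cball by linarith+
  qed
  have "compact B" by (simp add: B_def)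
  then have "closed {p \<in> B. h p \<le> c}" "closed {p \<in> B. c \<le> h p}"
    by (intro continuous_on_closed_Collect_le hB continuous_on_const compact_imp_closed; simp)+
  with \<open>compact B\<close> have "compact (B \<inter> {p \<in> B. h p \<le> c})" "compact (B \<inter> {p \<in> B. c \<le> h p})"
    by (blast intro: compact_Int_closed)+
  moreover have "B \<inter> {p \<in> B. P p} = {p \<in> B. P p}" for P by auto
  ultimately have "compact (U \<times> D)"
    unfolding U_def D_def by (intro compact_Times compact_Int_closed clS) simp_all
  then have "compact K"
    unfolding K_def by (intro compact_Int_closed closed_Collect_le continuous_intros)
  moreover have "(a, b) \<in> K"
    using ab c inB[of b a] by (auto simp: K_def U_def D_def)
  moreover have "continuous_on K (\<lambda>z. dist (fst z) (snd z))"
    by (intro continuous_intros)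
  ultimately obtain z where z: "z \<in> K" "\<And>w. w \<in> K \<Longrightarrow> dist (fst z) (snd z) \<le> dist (fst w) (snd w)"
    using continuous_attains_inf[of K "\<lambda>z. dist (fst z) (snd z)"] by blast
  obtain x y where xy: "z = (x, y)" by (cases z)
  define m where "m = (1 - l) * x + l * y"
  have xyK: "x \<in> S" "y \<in> S" "c \<le> h x" "h y \<le> c"
    "dist b y + k * dist x y \<le> k * dist a b"
    using z(1) by (auto simp: xy K_def U_def D_def)
  have mS: "m \<in> S" unfolding m_def using xyK by (intro lambda_convexD[OF cvS])
  have "x - m = l * (x - y)" "m - y = (1 - l) * (x - y)" by (auto simp: m_def algebra_simps)
  then have dm: "dist x m \<le> q * dist x y" "dist m y \<le> q * dist x y"
    using q by (auto simp: dist_norm norm_mult mult_right_mono)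
  have "dist x y \<le> q * dist x y"
  proof (cases "h m \<le> c")
    case True
    have "dist b m \<le> dist b y + dist m y" by (metis dist_commute dist_triangle)
    moreover have "k * dist x m \<le> k * (q * dist x y)"
      using dm k by (intro mult_left_mono) auto
    moreover have "q * dist x y + k * (q * dist x y) = k * dist x y"
      using arg_cong[OF k(2), of "\<lambda>t. t * dist x y"] by (simp add: algebra_simps)
    ultimately have "dist b m + k * dist x m \<le> k * dist a b"
      using xyK dm by linarith
    then have "(x, m) \<in> K"
      using True xyK mS inB[of m x] by (auto simp: K_def U_def D_def)
    then show ?thesis using z(2) dm by (force simp: xy)
  next
    case False
    have "q * dist x y \<le> 1 * dist x y" using q by (intro mult_right_mono) auto
    then have "k * dist m y \<le> k * dist x y"
      using dm k by (intro mult_left_mono) auto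
    then have "dist b y + k * dist m y \<le> k * dist a b"
      using xyK by linarith
    then have "(m, y) \<in> K"
      using False xyK mS inB[of y m] by (auto simp: K_def U_def D_def)
    then show ?thesis using z(2) dm by (force simp: xy)
  qed
  then have "(1 - q) * dist x y \<le> 0" by (simp add: algebra_simps)
  then have "x = y" using q by (simp add: mult_le_0_iff)
  then show thesis
    using that[of x] xyK inB(1)[of y x] by (auto simp: B_def k_def)
qed

section \<open>Parameters near 1/2\<close>

lemma convex_R_near_half_Im_pos:
  assumes l: "dist (1/2) l < 1/100" and im: "0 < Im l"
  shows "convex (R l)"
proof -
  have norms: "norm l \<le> 51/100" "norm (1 - l) \<le> 51/100"
    using l norm_triangle_ineq[of "1/2" "l - 1/2"] norm_triangle_ineq[of "1/2" "1/2 - l"]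
    by (simp_all add: dist_norm norm_minus_commute)
  have "l \<noteq> 0" using im by auto
  have Arg_l: "0 < Arg l" "Arg l < pi"
    using Arg_less_0[of l] Arg_eq_0 Arg_le_pi[of l] Arg_lt_pi[of l] im by auto
  \<comment> \<open>\<open>n\<close> turns by \<open>Arg l\<close> fit into a full circle and
    \<open>c\<close> is the angle left over. It lies between \<open>Arg 1 = 0\<close> and
    \<open>Arg l\<close>, so some \<open>p\<close> in \<open>R l\<close> near 1 has argument
    \<open>c\<close>, and \<open>l ^ n * p\<close> is a positive real.\<close>
  define n where "n = nat \<lfloor>2 * pi / Arg l\<rfloor>"
  define c where "c = 2 * pi - n * Arg l"
  have "2 \<le> 2 * pi / Arg l" using Arg_l by (simp add: field_simps)
  then have n: "2 \<le> n" "real n \<le> 2 * pi / Arg l" "2 * pi / Arg l < real n + 1"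
    unfolding n_def by linarith+
  then have c: "0 \<le> c" "c \<le> Arg l"
    using Arg_l by (simp_all add: c_def field_simps)
  \<comment> \<open>The radius is at most 51/49 times 51/100, below 3/5; a disk around 1 of radius
    less than 1 avoids the branch cut of \<open>Arg\<close>.\<close>
  have dist_l: "51/100 / (1 - 51/100) * dist l 1 \<le> 3/5"
    using norms by (simp add: dist_norm norm_minus_commute)
  have slit: "z \<notin> \<real>\<^sub>\<le>\<^sub>0" if "z \<in> cball 1 (3/5)" for z :: complex
    using that abs_Re_le_cmod[of "1 - z"] by (auto simp: dist_norm complex_nonpos_Reals_iff)
  have "continuous_on (cball 1 (51/100 / (1 - 51/100) * dist l 1)) Arg"
    by (rule continuous_on_subset[of "cball 1 (3/5)"])
       (use dist_l slit in \<open>auto intro!: continuous_at_imp_continuous_on continuous_at_Arg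
          intro: order_trans\<close>)
  then obtain p where p: "p \<in> R l" "p \<in> cball 1 (51/100 / (1 - 51/100) * dist l 1)" "Arg p = c"
    using lambda_clonvex_IVT[OF lambda_clonvex_R parameter_in_R one_in_R norms, of Arg c] c
    by auto
  have p1: "p \<in> cball 1 (3/5)" using p(2) dist_l by auto
  have "p \<noteq> 0" using slit[OF p1] by auto
  have "norm p \<le> 8/5" using p1 norm_triangle_ineq[of 1 "p - 1"] by (simp add: dist_norm norm_minus_commute)
  define r where "r = norm l ^ n * norm p"
  have "l ^ n * p = (norm l * cis (Arg l)) ^ n * (norm p * cis (Arg p))"
    by (simp flip: rcis_def add: rcis_cmod_Arg)
  also have "\<dots> = of_real r * cis (n * Arg l + c)"
    by (simp add: r_def power_mult_distrib Complex.DeMoivre p flip: cis_mult)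
  also have "\<dots> = of_real r" by (simp add: c_def)
  finally have eq: "l ^ n * p = of_real r" .
  have "l ^ j * p \<in> R l" for j
  proof (induction j)
    case (Suc j)
    then show ?case using lambda_convexD[OF lambda_convex_R zero_in_R Suc] by (simp add: mult.assoc)
  qed (simp add: p)
  with eq have "of_real r \<in> R l" by metis
  moreover have "0 < r" using \<open>l \<noteq> 0\<close> \<open>p \<noteq> 0\<close> by (simp add: r_def)
  moreover have "r < 1"
  proof -
    have "norm l ^ n \<le> norm l ^ 2" using n norms by (intro power_decreasing) auto
    also have "\<dots> \<le> (51/100) ^ 2" using norms by (intro power_mono) auto
    finally have "r \<le> (51/100)^2 * (8/5)"
      unfolding r_def using \<open>norm p \<le> 8/5\<close> by (intro mult_mono) auto
    then show ?thesis by (simp add: power2_eq_square)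
  qed
  ultimately show ?thesis by (rule convex_R_if_real_mem)
qed

lemma convex_R_near_half:
  assumes l: "dist (1/2) l < 1/100"
  shows "convex (R l)"
proof -
  \<comment> \<open>The reflection of \<open>l\<close> to \<open>1 - l\<close> changes the sign of
    the imaginary part and preserves \<open>R l\<close>.\<close>
  consider "0 < Im l" | "0 < Im (1 - l)" | "Im l = 0" by fastforce
  then show ?thesis
  proof cases
    case 1
    then show ?thesis using convex_R_near_half_Im_pos l by blast
  next
    case 2
    have "dist (1/2) (1 - l) = dist (1/2) l"
      by (simp add: dist_norm norm_minus_commute)
    then show ?thesis using convex_R_near_half_Im_pos[of "1 - l"] l 2 by (simp add: R_one_minus)
  next
    case 3
    have "\<bar>Re (1/2 - l)\<bar> < 1/100"
      using l abs_Re_le_cmod[of "1/2 - l"] unfolding dist_norm by linarith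
    then have "0 < Re l" "Re l < 1" by (auto simp: abs_if split: if_splits)
    moreover have "of_real (Re l) = l" using 3 by (simp add: complex_eq_iff)
    ultimately show ?thesis using convex_R_if_real_mem[of "Re l" l] parameter_in_R[of l] by simp
  qed
qed

section \<open>Approximation by polynomials and openness\<close>

text \<open>The points reached from 0 and 1 in finitely many steps, kept as functions of the
  parameter so that one construction can be evaluated at neighbouring parameters.\<close>

inductive_set hull_poly :: "(complex \<Rightarrow> complex) set" where
  zero: "(\<lambda>_. 0) \<in> hull_poly"
| one: "(\<lambda>_. 1) \<in> hull_poly"
| comb: "f \<in> hull_poly \<Longrightarrow> g \<in> hull_poly \<Longrightarrow> (\<lambda>l. (1 - l) * f l + l * g l) \<in> hull_poly"

lemma continuous_hull_poly: "f \<in> hull_poly \<Longrightarrow> continuous_on A f"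
  by (induction rule: hull_poly.induct) (auto intro!: continuous_intros)

lemma hull_poly_in_R: "f \<in> hull_poly \<Longrightarrow> f l \<in> R l"
  by (induction rule: hull_poly.induct)
     (auto intro: zero_in_R one_in_R lambda_convexD[OF lambda_convex_R])

lemma lambda_convex_closure:
  assumes "lambda_convex l S"
  shows "lambda_convex l (closure S)"
  unfolding lambda_convex_def
proof safe
  fix a b assume "a \<in> closure S" "b \<in> closure S"
  then obtain x y where "\<And>n::nat. x n \<in> S" "x \<longlonglongrightarrow> a" "\<And>n::nat. y n \<in> S" "y \<longlonglongrightarrow> b"
    unfolding closure_sequential by blast
  then show "(1 - l) * a + l * b \<in> closure S"
    unfolding closure_sequential
    by (intro exI[of _ "\<lambda>n. (1 - l) * x n + l * y n"])
       (auto intro!: lambda_convexD[OF assms] tendsto_intros)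
qed

text \<open>The values at \<open>l\<close> already form an \<open>l\<close>-convex set, and closure
  preserves this, so minimality of \<open>R l\<close> applies.\<close>

lemma R_subset_closure_hull_poly: "R l \<subseteq> closure ((\<lambda>f. f l) ` hull_poly)" (is "_ \<subseteq> closure ?Q")
proof (rule R_minimal)
  have "{0, 1} \<subseteq> ?Q"
    using imageI[OF hull_poly.zero, of "\<lambda>f. f l"] imageI[OF hull_poly.one, of "\<lambda>f. f l"] by simp
  then show "{0, 1} \<subseteq> closure ?Q" using closure_subset by blast
  have "lambda_convex l ?Q"
    unfolding lambda_convex_def
  proof safe
    fix f g assume "f \<in> hull_poly" "g \<in> hull_poly"
    from imageI[OF hull_poly.comb[OF this], of "\<lambda>f. f l"]
    show "(1 - l) * f l + l * g l \<in> ?Q" by simp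
  qed
  then show "lambda_clonvex l (closure ?Q)"
    by (simp add: lambda_clonvex_def lambda_convex_closure)
qed

theorem theorem7p4: "open {l :: complex. convex (R l)}"
proof (subst open_subopen, safe)
  fix l assume "convex (R l)"
  then have "1/2 \<in> closure ((\<lambda>f. f l) ` hull_poly)"
    using half_in_R_if_convex R_subset_closure_hull_poly by blast
  then obtain f where f: "f \<in> hull_poly" "dist (f l) (1/2) < 1/100"
    unfolding closure_approachable by (auto dest!: spec[of _ "1/100"])
  have "convex (R k)" if "dist (1/2) (f k) < 1/100" for k
  proof -
    have "1/2 \<in> R (f k)" using convex_R_near_half[OF that] by (rule half_in_R_if_convex)
    then have "1/2 \<in> R k" using R_subset_R hull_poly_in_R[OF f(1)] by blast
    then show ?thesis using convex_R_if_real_mem[of "1/2" k] by simp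
  qed
  \<comment> \<open>By continuity the same \<open>f\<close> serves all parameters in this
    neighbourhood of \<open>l\<close>.\<close>
  moreover have "open (f -` ball (1/2) (1/100))"
    using continuous_hull_poly[OF f(1)] by (intro open_vimage) auto
  ultimately show "\<exists>T. open T \<and> l \<in> T \<and> T \<subseteq> {l. convex (R l)}"
    using f(2) by (intro exI[of _ "f -` ball (1/2) (1/100)"]) (auto simp: dist_commute)
qed

end
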